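(* Let $f^0(x,y)$ be a curvature surface on $D=\{(x,y)\in\mathbb{R}^2:x>0\}$ and $F^0=[\phi,X^0_\alpha,X^0_\beta,\xi]$ the frame field determining $f^0$. Then: (1) Along any $y$-curve $y\mapsto f^0(x,y)$ ($x$ fixed), the vector $(-B_2X^0_\alpha+C_2\xi)(x,y)$ is constant, where $B_2(x)=-\frac12\frac{X_0'}{x}-\sqrt5$ and $C_2(x)=X_0''-\frac{X_0'}{x}$. That is, an analytic unit vector $\tilde{\boldsymbol{u}}(x)$ of $x$ is determined by $\tilde{\boldsymbol{u}}(x)=(B_2^2+C_2^2)^{-1/2}(x)\,(-B_2X^0_\alpha+C_2\xi)(x,y)$, and $(B_2^2+C_2^2)(x)=\frac{X_0'}{x}\big(2X_0-xX_0'-\frac{X_0'}{x}+\sqrt5\big)>0$ holds for $x\in\mathbb{R}$. (2) Let $\tilde{\boldsymbol{f}}(x,y)$ be the analytic unit vector $\tilde{\boldsymbol{f}}(x,y):=(B_2^2+C_2^2)^{-1/2}(x)(B_2\xi+C_2X^0_\alpha)(x,y)$. Then the surface, regarded as a one-parameter family of $y$-curves, is expressed as $$f^0(x,y)=(B_2^2+C_2^2)^{-1/2}(x)\,\tilde{\boldsymbol{f}}(x,y)+\tilde A(x),$$ where $\tilde A(x)$ is an $\mathbb{R}^4$-valued analytic function of $x$ determined uniquely up to a parallel translation. (3) Any $y$-curve $y\mapsto f^0(x,y)$ lies on a standard $2$-sphere $\mathbb{S}^2_x$ of radius $(B_2^2+C_2^2)^{-1/2}(x)$ in an affine hyperplane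 $\mathbb{R}^3_x$ perpendicular to $\tilde{\boldsymbol{u}}(x)$, and $\tilde A(x)$ is the center of $\mathbb{S}^2_x$.
   Context: $X_0(x)=\frac52+\sum_{k\ge1}a_kx^{2k}$ (analytic on $\mathbb{R}$), $a_1=1$, $2(k+1)(4k^2+\frac54)a_{k+1}+(2k-1)a_k=0$ $(k\ge1)$; $X_0'(x)/x$ is extended analytically to $x=0$ with value $2$. $h(x,y)=2X_0-xX_0'+y^2\frac{X_0'}{x}+\sqrt5$ (positive). On $D$ put $a_1=\frac{2y}{xh}(X_0+\frac{\sqrt5}{2})$, $b_1=-\frac{1}{xh}(X_0+\frac{\sqrt5}{2}+\sqrt5(x^2-y^2))$, $c_1=-\frac{2}{xh}(X_0+\frac{\sqrt5}{2})$, $a_2=-\frac1h(2X_0+\sqrt5-(x^2+y^2)\frac{X_0'}{x})$, $b_2=-\frac{2y}{h}(\frac{X_0'}{2x}+\sqrt5)$, $c_2=\frac{2y}{h}(X_0''-\frac{X_0'}{x})$. The frame field is an analytic orthonormal frame field $F^0=[\phi,X^0_\alpha,X^0_\beta,\xi]$ of $\mathbb{R}^4$ on $D$ satisfying $\phi_x=-a_1X^0_\alpha$, $\xi_x=b_1X^0_\alpha$, $(X^0_\beta)_x=c_1X^0_\alpha$, $(X^0_\alpha)_x=a_1\phi-b_1\xi-c_1X^0_\beta$, $\phi_y=-a_2X^0_\beta$, $\xi_y=b_2X^0_\beta$, $(X^0_\alpha)_y=c_2X^0_\beta$, $(X^0_\beta)_y=a_2\phi-b_2\xi-c_2X^0_\alpha$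 (it exists and is unique up to left multiplication by a constant orthogonal matrix). The curvature surface $f^0:D\to\mathbb{R}^4$ determined by $F^0$ is the analytic map, unique up to translation, with $df^0=\frac{x^2-y^2}{xh}X^0_\alpha dx+\frac{2y}{h}X^0_\beta dy$. *)

theory Defs
  imports "HOL-Analysis.Analysis"
begin

text \<open>
  Real analyticity of vector-valued maps of one and of two real variables: every point of the
  set has a neighbourhood on which the map is the sum of a power series. In two variables the
  double series is summed unconditionally. Both are used on open sets only.
\<close>

definition real_analytic_on :: "(real \<Rightarrow> 'b::real_normed_vector) \<Rightarrow> real set \<Rightarrow> bool"
  where "real_analytic_on f S \<longleftrightarrow>
    (\<forall>x0\<in>S. \<exists>r>0. \<exists>c::nat \<Rightarrow> 'b. \<forall>x. \<bar>x - x0\<bar> < r \<longrightarrow>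
      (\<lambda>n. (x - x0) ^ n *\<^sub>R c n) sums f x)"

definition real_analytic2_on ::
    "(real \<times> real \<Rightarrow> 'b::real_normed_vector) \<Rightarrow> (real \<times> real) set \<Rightarrow> bool"
  where "real_analytic2_on f S \<longleftrightarrow>
    (\<forall>(x0, y0)\<in>S. \<exists>r>0. \<exists>c::nat \<times> nat \<Rightarrow> 'b. \<forall>x y. \<bar>x - x0\<bar> < r \<and> \<bar>y - y0\<bar> < r \<longrightarrow>
      ((\<lambda>(m, n). ((x - x0) ^ m * (y - y0) ^ n) *\<^sub>R c (m, n)) has_sum f (x, y)) UNIV)"

definition D :: "(real \<times> real) set"
  where "D = {(x, y). x > 0}"

text \<open>
  Coefficients of the even power series \<open>X0\<close>. For \<open>k \<ge> 1\<close> the recursion is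
  \<open>2(k+1)(4k^2 + 5/4) a_(k+1) + (2k-1) a_k = 0\<close>, solved for \<open>a_(k+1)\<close>.
\<close>

fun X0_coeff :: "nat \<Rightarrow> real" where
  "X0_coeff 0 = 5 / 2"
| "X0_coeff (Suc 0) = 1"
| "X0_coeff (Suc (Suc j)) =
    (let k = real (Suc j)
     in - ((2 * k - 1) * X0_coeff (Suc j)) / (2 * (k + 1) * (4 * k\<^sup>2 + 5 / 4)))"

definition X0 :: "real \<Rightarrow> real"
  where "X0 x = (\<Sum>k. X0_coeff k * x ^ (2 * k))"

definition dX0 :: "real \<Rightarrow> real"
  where "dX0 = deriv X0"

definition ddX0 :: "real \<Rightarrow> real"
  where "ddX0 = deriv dX0"

text \<open>The quotient \<open>X0'(x) / x\<close> with its analytic extension to \<open>x = 0\<close>.\<close>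

definition X0q :: "real \<Rightarrow> real"
  where "X0q x = (if x = 0 then 2 else dX0 x / x)"

definition h :: "real \<Rightarrow> real \<Rightarrow> real"
  where "h x y = 2 * X0 x - x * dX0 x + y\<^sup>2 * X0q x + sqrt 5"

definition a\<^sub>1 :: "real \<Rightarrow> real \<Rightarrow> real"
  where "a\<^sub>1 x y = 2 * y / (x * h x y) * (X0 x + sqrt 5 / 2)"

definition b\<^sub>1 :: "real \<Rightarrow> real \<Rightarrow> real"
  where "b\<^sub>1 x y = - (1 / (x * h x y)) * (X0 x + sqrt 5 / 2 + sqrt 5 * (x\<^sup>2 - y\<^sup>2))"

definition c\<^sub>1 :: "real \<Rightarrow> real \<Rightarrow> real"
  where "c\<^sub>1 x y = - (2 / (x * h x y)) * (X0 x + sqrt 5 / 2)"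

definition a\<^sub>2 :: "real \<Rightarrow> real \<Rightarrow> real"
  where "a\<^sub>2 x y = - (1 / h x y) * (2 * X0 x + sqrt 5 - (x\<^sup>2 + y\<^sup>2) * X0q x)"

definition b\<^sub>2 :: "real \<Rightarrow> real \<Rightarrow> real"
  where "b\<^sub>2 x y = - (2 * y / h x y) * (X0q x / 2 + sqrt 5)"

definition c\<^sub>2 :: "real \<Rightarrow> real \<Rightarrow> real"
  where "c\<^sub>2 x y = 2 * y / h x y * (ddX0 x - X0q x)"

definition orthonormal_frame :: "real^4 \<Rightarrow> real^4 \<Rightarrow> real^4 \<Rightarrow> real^4 \<Rightarrow> bool"
  where "orthonormal_frame p q r s \<longleftrightarrow>
    norm p = 1 \<and> norm q = 1 \<and> norm r = 1 \<and> norm s = 1 \<and>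
    p \<bullet> q = 0 \<and> p \<bullet> r = 0 \<and> p \<bullet> s = 0 \<and> q \<bullet> r = 0 \<and> q \<bullet> s = 0 \<and> r \<bullet> s = 0"

text \<open>
  \<open>frame_field \<phi> X\<^sub>\<alpha> X\<^sub>\<beta> \<xi>\<close>: the maps form an analytic orthonormal frame field
  \<open>[\<phi>, X\<^sub>\<alpha>, X\<^sub>\<beta>, \<xi>]\<close> on \<open>D\<close> solving the structure equations. The solution is
  unique only up to a constant orthogonal matrix, hence a predicate.
\<close>

definition frame_field ::
    "(real \<times> real \<Rightarrow> real^4) \<Rightarrow> (real \<times> real \<Rightarrow> real^4) \<Rightarrow>
     (real \<times> real \<Rightarrow> real^4) \<Rightarrow> (real \<times> real \<Rightarrow> real^4) \<Rightarrow> bool"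
  where "frame_field \<phi> X\<^sub>\<alpha> X\<^sub>\<beta> \<xi> \<longleftrightarrow>
    real_analytic2_on \<phi> D \<and> real_analytic2_on X\<^sub>\<alpha> D \<and>
    real_analytic2_on X\<^sub>\<beta> D \<and> real_analytic2_on \<xi> D \<and>
    (\<forall>(x, y)\<in>D.
      orthonormal_frame (\<phi> (x, y)) (X\<^sub>\<alpha> (x, y)) (X\<^sub>\<beta> (x, y)) (\<xi> (x, y)) \<and>
      ((\<lambda>s. \<phi> (s, y)) has_vector_derivative - a\<^sub>1 x y *\<^sub>R X\<^sub>\<alpha> (x, y)) (at x) \<and>
      ((\<lambda>s. \<xi> (s, y)) has_vector_derivative b\<^sub>1 x y *\<^sub>R X\<^sub>\<alpha> (x, y)) (at x) \<and>
      ((\<lambda>s. X\<^sub>\<beta> (s, y)) has_vector_derivative c\<^sub>1 x y *\<^sub>R X\<^sub>\<alpha> (x, y)) (at x) \<and>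
      ((\<lambda>s. X\<^sub>\<alpha> (s, y)) has_vector_derivative
        a\<^sub>1 x y *\<^sub>R \<phi> (x, y) - b\<^sub>1 x y *\<^sub>R \<xi> (x, y) - c\<^sub>1 x y *\<^sub>R X\<^sub>\<beta> (x, y)) (at x) \<and>
      ((\<lambda>t. \<phi> (x, t)) has_vector_derivative - a\<^sub>2 x y *\<^sub>R X\<^sub>\<beta> (x, y)) (at y) \<and>
      ((\<lambda>t. \<xi> (x, t)) has_vector_derivative b\<^sub>2 x y *\<^sub>R X\<^sub>\<beta> (x, y)) (at y) \<and>
      ((\<lambda>t. X\<^sub>\<alpha> (x, t)) has_vector_derivative c\<^sub>2 x y *\<^sub>R X\<^sub>\<beta> (x, y)) (at y) \<and>
      ((\<lambda>t. X\<^sub>\<beta> (x, t)) has_vector_derivative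
        a\<^sub>2 x y *\<^sub>R \<phi> (x, y) - b\<^sub>2 x y *\<^sub>R \<xi> (x, y) - c\<^sub>2 x y *\<^sub>R X\<^sub>\<alpha> (x, y)) (at y))"

text \<open>
  \<open>f\<close> is a curvature surface determined by the frame; the defining equation for \<open>df\<close>
  involves only \<open>X\<^sub>\<alpha>\<close> and \<open>X\<^sub>\<beta>\<close>.
\<close>

definition curvature_surface ::
    "(real \<times> real \<Rightarrow> real^4) \<Rightarrow> (real \<times> real \<Rightarrow> real^4) \<Rightarrow>
     (real \<times> real \<Rightarrow> real^4) \<Rightarrow> bool"
  where "curvature_surface X\<^sub>\<alpha> X\<^sub>\<beta> f \<longleftrightarrow>
    real_analytic2_on f D \<and>
    (\<forall>(x, y)\<in>D.
      (f has_derivative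
        (\<lambda>(dx, dy). ((x\<^sup>2 - y\<^sup>2) / (x * h x y) * dx) *\<^sub>R X\<^sub>\<alpha> (x, y)
                  + (2 * y / h x y * dy) *\<^sub>R X\<^sub>\<beta> (x, y))) (at (x, y)))"

definition B\<^sub>2 :: "real \<Rightarrow> real"
  where "B\<^sub>2 x = - (1 / 2) * X0q x - sqrt 5"

definition C\<^sub>2 :: "real \<Rightarrow> real"
  where "C\<^sub>2 x = ddX0 x - X0q x"

definition rad :: "real \<Rightarrow> real"
  where "rad x = ((B\<^sub>2 x)\<^sup>2 + (C\<^sub>2 x)\<^sup>2) powr (- 1 / 2)"

definition f_tilde ::
    "(real \<times> real \<Rightarrow> real^4) \<Rightarrow> (real \<times> real \<Rightarrow> real^4) \<Rightarrow> real \<times> real \<Rightarrow> real^4"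
  where "f_tilde X\<^sub>\<alpha> \<xi> = (\<lambda>(x, y). rad x *\<^sub>R (B\<^sub>2 x *\<^sub>R \<xi> (x, y) + C\<^sub>2 x *\<^sub>R X\<^sub>\<alpha> (x, y)))"

end

theory Submission
  imports Defs "HOL-Complex_Analysis.Complex_Analysis"
begin

text \<open>
  With $t = x^2$, $X_0(x) = g(t)$ for an entire $g$. The recursion also holds at $k = 0$, so it is
  equivalent to an ordinary differential equation for $g$, and this equation has a first integral
  whose value is read off at $t = 0$. That first integral is the formula for $B_2^2 + C_2^2$, and it
  forbids zeros of $g'$, which gives the positivity of $X_0'/x$ and of $B_2^2 + C_2^2$.
  The coefficients satisfy $b_2 = (2y/h) B_2$ and $c_2 = (2y/h) C_2$, so the $y$-derivatives
  of $-B_2 X_\alpha + C_2 \xi$ and of $f - (B_2^2 + C_2^2)^{-1} (B_2 \xi + C_2 X_\alpha)$ vanish.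
\<close>

section \<open>Closure properties of analytic maps of one and two real variables\<close>

text \<open>In a Euclidean space unconditional summability is absolute: it passes to each
  coordinate, real families that are summable are absolutely summable, and the norm is at most the
  sum of the absolute coordinates. The double family is then absolutely summable, so it may be
  summed iteratively. This is the input for the Cauchy product below.\<close>

lemma has_sum_scaleR_product:
  fixes s :: "'i \<Rightarrow> real" and v :: "'j \<Rightarrow> 'b::euclidean_space"
  assumes s: "(s has_sum a) UNIV" and v: "(v has_sum w) UNIV"
  shows "((\<lambda>(i, j). s i *\<^sub>R v j) has_sum a *\<^sub>R w) UNIV"
proof -
  have abs_s: "(\<lambda>i. \<bar>s i\<bar>) summable_on UNIV"
    using s summable_on_iff_abs_summable_on_real[of s UNIV] by (auto simp: summable_on_def)
  have abs_comp: "(\<lambda>j. \<bar>v j \<bullet> b\<bar>) summable_on UNIV" for b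
    using has_sum_bounded_linear[OF bounded_linear_inner_left v, of b]
      summable_on_iff_abs_summable_on_real[of "\<lambda>j. v j \<bullet> b" UNIV] by (auto simp: summable_on_def)
  have "(\<lambda>j. \<Sum>b\<in>F. \<bar>v j \<bullet> b\<bar>) summable_on UNIV" if "finite F" for F
    using that by (induction rule: finite_induct) (auto intro: summable_on_add abs_comp)
  then have "(\<lambda>j. \<Sum>b\<in>Basis. \<bar>v j \<bullet> b\<bar>) summable_on UNIV"
    by simp
  then have abs_v: "(\<lambda>j. norm (v j)) summable_on UNIV"
    by (rule summable_on_comparison_test) (auto simp: norm_le_l1)
  obtain V where V: "((\<lambda>j. norm (v j)) has_sum V) UNIV"
    using abs_v by (auto simp: summable_on_def)
  have "(\<lambda>(i, j). \<bar>s i\<bar> * norm (v j)) summable_on (SIGMA i:UNIV. UNIV)"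
  proof (rule summable_on_SigmaI)
    show "((\<lambda>j. case (i, j) of (i, j) \<Rightarrow> \<bar>s i\<bar> * norm (v j)) has_sum \<bar>s i\<bar> * V) UNIV" for i
      using has_sum_cmult_right[OF V, of "\<bar>s i\<bar>"] by simp
    show "(\<lambda>i. \<bar>s i\<bar> * V) summable_on UNIV"
      using abs_s by (rule summable_on_cmult_left)
  qed auto
  then have "(\<lambda>p. norm (case p of (i, j) \<Rightarrow> s i *\<^sub>R v j)) summable_on (SIGMA i:UNIV. UNIV)"
    by (simp add: case_prod_unfold)
  then have summable: "(\<lambda>(i, j). s i *\<^sub>R v j) summable_on (SIGMA i:UNIV. UNIV)"
    by (rule abs_summable_summable)
  have "((\<lambda>j. s i *\<^sub>R v j) has_sum s i *\<^sub>R w) UNIV" for i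
    using v by (rule has_sum_scaleR)
  moreover have "((\<lambda>i. s i *\<^sub>R w) has_sum a *\<^sub>R w) UNIV"
    using s by (rule has_sum_bounded_linear[OF bounded_linear_scaleR_left])
  ultimately have "((\<lambda>(i, j). s i *\<^sub>R v j) has_sum a *\<^sub>R w) (SIGMA i:UNIV. UNIV)"
    by (intro has_sum_SigmaI[OF _ _ summable]) auto
  then show ?thesis by simp
qed

lemma real_analytic2_onE:
  assumes "real_analytic2_on f S" "(x0, y0) \<in> S"
  obtains r c where "r > 0" "\<And>x y. \<bar>x - x0\<bar> < r \<Longrightarrow> \<bar>y - y0\<bar> < r \<Longrightarrow>
      ((\<lambda>(m, n). ((x - x0) ^ m * (y - y0) ^ n) *\<^sub>R c (m, n)) has_sum f (x, y)) UNIV"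
  using bspec[OF assms(1)[unfolded real_analytic2_on_def] assms(2)] unfolding prod.case by blast

lemma real_analytic2_onI:
  assumes "\<And>x0 y0. (x0, y0) \<in> S \<Longrightarrow> \<exists>r>0. \<exists>c. \<forall>x y. \<bar>x - x0\<bar> < r \<and> \<bar>y - y0\<bar> < r \<longrightarrow>
      ((\<lambda>(m, n). ((x - x0) ^ m * (y - y0) ^ n) *\<^sub>R c (m, n)) has_sum f (x, y)) UNIV"
  shows "real_analytic2_on f S"
  unfolding real_analytic2_on_def using assms by (intro ballI) (auto simp del: split_paired_All)

text \<open>A Cauchy product in the first variable only: since \<open>s\<close> does not depend on
  \<open>y\<close>, the exponent of \<open>y - y0\<close> is carried along unchanged.\<close>

lemma real_analytic2_on_scaleR_left:
  fixes v :: "real \<times> real \<Rightarrow> 'b::euclidean_space"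
  assumes s: "real_analytic_on s T" and v: "real_analytic2_on v S" and ST: "fst ` S \<subseteq> T"
  shows "real_analytic2_on (\<lambda>(x, y). s x *\<^sub>R v (x, y)) S"
proof (rule real_analytic2_onI)
  fix x0 y0 assume xy: "(x0, y0) \<in> S"
  then have "x0 \<in> T" using ST by force
  then obtain r1 c where r1: "r1 > 0"
    and c: "\<And>x. \<bar>x - x0\<bar> < r1 \<Longrightarrow> (\<lambda>n. (x - x0) ^ n *\<^sub>R c n) sums s x"
    using s unfolding real_analytic_on_def by blast
  obtain r2 d where r2: "r2 > 0"
    and d: "\<And>x y. \<bar>x - x0\<bar> < r2 \<Longrightarrow> \<bar>y - y0\<bar> < r2 \<Longrightarrow>
      ((\<lambda>(m, n). ((x - x0) ^ m * (y - y0) ^ n) *\<^sub>R d (m, n)) has_sum v (x, y)) UNIV"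
    using real_analytic2_onE[OF v xy] by blast
  define e where "e = (\<lambda>(k, n). \<Sum>i\<le>k. c i *\<^sub>R d (k - i, n))"
  have "((\<lambda>(k, n). ((x - x0) ^ k * (y - y0) ^ n) *\<^sub>R e (k, n)) has_sum s x *\<^sub>R v (x, y)) UNIV"
    if x: "\<bar>x - x0\<bar> < min r1 r2" and y: "\<bar>y - y0\<bar> < min r1 r2" for x y
  proof -
    define \<xi> \<eta> where "\<xi> = x - x0" and "\<eta> = y - y0"
    \<comment> \<open>Analyticity in one variable supplies only ordered convergence by
      \<open>sums\<close>. Convergence at a radius \<open>R\<close> strictly between gives absolute
      convergence at the point itself, hence the unordered sum required by the product.\<close>
    obtain R where R: "\<bar>\<xi>\<bar> < R" "R < r1"
      using x dense[of "\<bar>\<xi>\<bar>" r1] by (auto simp: \<xi>_def)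
    have "summable (\<lambda>n. c n * R ^ n)"
      using c[of "x0 + R"] R by (auto simp: sums_iff mult.commute)
    then have "summable (\<lambda>n. norm (c n * \<xi> ^ n))"
      by (rule powser_insidea) (use R in auto)
    then have sum_s: "((\<lambda>n. \<xi> ^ n * c n) has_sum s x) UNIV"
      using c[of x] x by (intro norm_summable_imp_has_sum) (auto simp: \<xi>_def mult.commute)
    have sum_v: "((\<lambda>(m, n). (\<xi> ^ m * \<eta> ^ n) *\<^sub>R d (m, n)) has_sum v (x, y)) UNIV"
      using d[of x y] x y by (simp add: \<xi>_def \<eta>_def)
    have prod: "((\<lambda>(i, (m, n)). (\<xi> ^ i * c i) *\<^sub>R (\<xi> ^ m * \<eta> ^ n) *\<^sub>R d (m, n))
        has_sum s x *\<^sub>R v (x, y)) UNIV"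
      using has_sum_scaleR_product[OF sum_s sum_v] by (simp add: case_prod_unfold)
    \<comment> \<open>Regroup the triple sum by the total exponent \<open>k = i + m\<close> of
      \<open>x - x0\<close>. For fixed \<open>(k, n)\<close> only the finitely many
      \<open>i \<le> k\<close> occur, so the inner sums are finite.\<close>
    have "((\<lambda>((k, n), i). (\<xi> ^ k * \<eta> ^ n) *\<^sub>R c i *\<^sub>R d (k - i, n))
        has_sum s x *\<^sub>R v (x, y)) (SIGMA p:UNIV. {..fst p})"
      by (rule iffD1[OF has_sum_reindex_bij_witness prod,
            of "\<lambda>((k, n), i). (i, (k - i, n))" "\<lambda>(i, (m, n)). ((i + m, n), i)"])
        (auto simp: power_add mult_ac)
    then have "((\<lambda>(k, n). \<Sum>i\<le>k. (\<xi> ^ k * \<eta> ^ n) *\<^sub>R c i *\<^sub>R d (k - i, n))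
        has_sum s x *\<^sub>R v (x, y)) UNIV"
      by (rule has_sum_SigmaD) (auto simp: case_prod_unfold intro!: has_sum_finite)
    then show ?thesis
      by (simp add: e_def \<xi>_def \<eta>_def scaleR_sum_right case_prod_unfold)
  qed
  then show "\<exists>r>0. \<exists>e. \<forall>x y. \<bar>x - x0\<bar> < r \<and> \<bar>y - y0\<bar> < r \<longrightarrow>
      ((\<lambda>(m, n). ((x - x0) ^ m * (y - y0) ^ n) *\<^sub>R e (m, n)) has_sum
        (case (x, y) of (x, y) \<Rightarrow> s x *\<^sub>R v (x, y))) UNIV"
    using r1 r2 by (intro exI[of _ "min r1 r2"] conjI exI[of _ e]) auto
qed

lemma real_analytic2_on_add:
  assumes "real_analytic2_on f S" "real_analytic2_on g S"
  shows "real_analytic2_on (\<lambda>p. f p + g p) S"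
proof (rule real_analytic2_onI)
  fix x0 y0 assume xy: "(x0, y0) \<in> S"
  obtain r1 c where r1: "r1 > 0"
    and c: "\<And>x y. \<bar>x - x0\<bar> < r1 \<Longrightarrow> \<bar>y - y0\<bar> < r1 \<Longrightarrow>
      ((\<lambda>(m, n). ((x - x0) ^ m * (y - y0) ^ n) *\<^sub>R c (m, n)) has_sum f (x, y)) UNIV"
    using real_analytic2_onE[OF assms(1) xy] by blast
  obtain r2 d where r2: "r2 > 0"
    and d: "\<And>x y. \<bar>x - x0\<bar> < r2 \<Longrightarrow> \<bar>y - y0\<bar> < r2 \<Longrightarrow>
      ((\<lambda>(m, n). ((x - x0) ^ m * (y - y0) ^ n) *\<^sub>R d (m, n)) has_sum g (x, y)) UNIV"
    using real_analytic2_onE[OF assms(2) xy] by blast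
  have "((\<lambda>(m, n). ((x - x0) ^ m * (y - y0) ^ n) *\<^sub>R (c (m, n) + d (m, n)))
      has_sum f (x, y) + g (x, y)) UNIV"
    if "\<bar>x - x0\<bar> < min r1 r2" and "\<bar>y - y0\<bar> < min r1 r2" for x y
    using has_sum_add[OF c[of x y] d[of x y]] that
    by (simp add: scaleR_add_right case_prod_unfold)
  then show "\<exists>r>0. \<exists>e. \<forall>x y. \<bar>x - x0\<bar> < r \<and> \<bar>y - y0\<bar> < r \<longrightarrow>
      ((\<lambda>(m, n). ((x - x0) ^ m * (y - y0) ^ n) *\<^sub>R e (m, n)) has_sum f (x, y) + g (x, y)) UNIV"
    using r1 r2 by (intro exI[of _ "min r1 r2"] conjI exI[of _ "\<lambda>p. c p + d p"]) auto
qed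

lemma real_analytic2_on_uminus:
  assumes "real_analytic2_on f S"
  shows "real_analytic2_on (\<lambda>p. - f p) S"
proof (rule real_analytic2_onI)
  fix x0 y0 assume "(x0, y0) \<in> S"
  then obtain r c where "r > 0" and c: "\<And>x y. \<bar>x - x0\<bar> < r \<Longrightarrow> \<bar>y - y0\<bar> < r \<Longrightarrow>
      ((\<lambda>(m, n). ((x - x0) ^ m * (y - y0) ^ n) *\<^sub>R c (m, n)) has_sum f (x, y)) UNIV"
    using real_analytic2_onE[OF assms] by blast
  then show "\<exists>r>0. \<exists>c. \<forall>x y. \<bar>x - x0\<bar> < r \<and> \<bar>y - y0\<bar> < r \<longrightarrow>
      ((\<lambda>(m, n). ((x - x0) ^ m * (y - y0) ^ n) *\<^sub>R c (m, n)) has_sum - f (x, y)) UNIV"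
    using has_sum_bounded_linear[OF bounded_linear_minus[OF bounded_linear_ident] c]
    by (intro exI[of _ r] conjI exI[of _ "\<lambda>p. - c p"]) (auto simp: case_prod_unfold)
qed

lemma real_analytic2_on_const: "real_analytic2_on (\<lambda>_. v) S"
proof (rule real_analytic2_onI)
  fix x0 y0 :: real
  have "((\<lambda>(m, n). ((x - x0) ^ m * (y - y0) ^ n) *\<^sub>R (if (m, n) = (0, 0) then v else 0))
      has_sum v) UNIV" for x y
    using has_sum_finite[of "{(0::nat, 0::nat)}" "\<lambda>_. v"]
    by (subst has_sum_cong_neutral[where T = "{(0, 0)}" and g = "\<lambda>_. v"]) (auto split: if_splits)
  then show "\<exists>r>0. \<exists>c. \<forall>x y. \<bar>x - x0\<bar> < r \<and> \<bar>y - y0\<bar> < r \<longrightarrow>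
      ((\<lambda>(m, n). ((x - x0) ^ m * (y - y0) ^ n) *\<^sub>R c (m, n)) has_sum v) UNIV"
    by (intro exI[of _ 1] conjI exI[of _ "\<lambda>p. if p = (0, 0) then v else 0"]) auto
qed

lemma real_analytic_on_slice:
  assumes f: "real_analytic2_on f S" and T: "\<And>x. x \<in> T \<Longrightarrow> (x, y) \<in> S"
  shows "real_analytic_on (\<lambda>x. f (x, y)) T"
  unfolding real_analytic_on_def
proof safe
  fix x0 assume "x0 \<in> T"
  then obtain r c where r: "r > 0"
    and c: "\<And>x y'. \<bar>x - x0\<bar> < r \<Longrightarrow> \<bar>y' - y\<bar> < r \<Longrightarrow>
      ((\<lambda>(m, n). ((x - x0) ^ m * (y' - y) ^ n) *\<^sub>R c (m, n)) has_sum f (x, y')) UNIV"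
    using real_analytic2_onE[OF f T] by blast
  have "(\<lambda>n. (x - x0) ^ n *\<^sub>R c (n, 0)) sums f (x, y)" if "\<bar>x - x0\<bar> < r" for x
  proof -
    have "((\<lambda>(m, n). ((x - x0) ^ m * (y - y) ^ n) *\<^sub>R c (m, n)) has_sum f (x, y)) UNIV"
      using c[of x y] that r by simp
    \<comment> \<open>At the centre the powers of \<open>y - y\<close> vanish except for
      \<open>n = 0\<close>, where \<open>0 ^ 0 = 1\<close>; only the first column of coefficients
      survives.\<close>
    then have "((\<lambda>(m, n). (x - x0) ^ m *\<^sub>R c (m, n)) has_sum f (x, y)) (UNIV \<times> {0})"
      by (rule iffD1[OF has_sum_cong_neutral, rotated -1]) auto
    then have "((\<lambda>m. (x - x0) ^ m *\<^sub>R c (m, 0)) has_sum f (x, y)) UNIV"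
      by (rule iffD1[OF has_sum_reindex_bij_witness[where j = fst and i = "\<lambda>m. (m, 0)"], rotated -1])
        auto
    then show ?thesis by (rule has_sum_imp_sums)
  qed
  then show "\<exists>r>0. \<exists>c. \<forall>x. \<bar>x - x0\<bar> < r \<longrightarrow> (\<lambda>n. (x - x0) ^ n *\<^sub>R c n) sums f (x, y)"
    using r by (intro exI[of _ r] conjI exI[of _ "\<lambda>n. c (n, 0)"]) auto
qed

text \<open>The Taylor series of \<open>F\<close> at a real centre converges on a disc inside
  \<open>U\<close>. At real points the powers are real, so taking real parts acts on the
  coefficients alone and leaves a real power series for \<open>s\<close>.\<close>

lemma real_analytic_on_holomorphic_extension:
  assumes F: "F holomorphic_on U" "open U"
    and ext: "\<And>x. x \<in> T \<Longrightarrow> complex_of_real x \<in> U" "\<And>x. complex_of_real x \<in> U \<Longrightarrow> Re (F (of_real x)) = s x"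
  shows "real_analytic_on s T"
  unfolding real_analytic_on_def
proof safe
  fix x0 assume "x0 \<in> T"
  then obtain r where r: "r > 0" "ball (of_real x0) r \<subseteq> U"
    using ext(1) F(2) openE by meson
  define c where "c n = Re ((deriv ^^ n) F (of_real x0) / fact n)" for n
  have "(\<lambda>n. (x - x0) ^ n *\<^sub>R c n) sums s x" if x: "\<bar>x - x0\<bar> < r" for x
  proof -
    have mem: "complex_of_real x \<in> ball (of_real x0) r"
      using x by (simp add: dist_real_def abs_minus_commute)
    then have "(\<lambda>n. Re ((deriv ^^ n) F (of_real x0) / fact n * (of_real x - of_real x0) ^ n))
        sums Re (F (of_real x))"
      using holomorphic_power_series[of F "of_real x0" r] holomorphic_on_subset[OF F(1) r(2)]
      by (intro sums_Re) blast
    moreover have "Re (w * (of_real x - of_real x0) ^ n) = (x - x0) ^ n * Re w" for w n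
      by (simp flip: of_real_diff of_real_power)
    moreover have "Re (F (of_real x)) = s x"
      using mem r(2) ext(2) by blast
    ultimately show ?thesis by (simp only: c_def real_scaleR_def)
  qed
  then show "\<exists>r>0. \<exists>c. \<forall>x. \<bar>x - x0\<bar> < r \<longrightarrow> (\<lambda>n. (x - x0) ^ n *\<^sub>R c n) sums s x"
    using r by blast
qed

section \<open>The power series of \<open>X0\<close>, its differential equation and its first
  integral\<close>

lemma summable_diffs_funpow:
  fixes c :: "nat \<Rightarrow> 'a::{real_normed_field,banach}"
  assumes "\<And>x. summable (\<lambda>n. c n * x ^ n)"
  shows "summable (\<lambda>n. (diffs ^^ j) c n * x ^ n)"
proof (induction j arbitrary: x)
  case (Suc j)
  then show ?case by (simp add: termdiff_converges_all)
qed (simp add: assms)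

text \<open>This is the Euler operator \<open>x d/dx\<close> on coefficients. It turns a recursion
  with polynomial coefficients in the index into a differential equation.\<close>

lemma powser_of_nat_mult_sums:
  fixes c :: "nat \<Rightarrow> 'a::{real_normed_field,banach}"
  assumes "\<And>x. summable (\<lambda>n. c n * x ^ n)"
  shows "(\<lambda>n. of_nat n * c n * x ^ n) sums (x * (\<Sum>n. diffs c n * x ^ n))"
proof -
  have "(\<lambda>n. x * (diffs c n * x ^ n)) sums (x * (\<Sum>n. diffs c n * x ^ n))"
    by (intro sums_mult summable_sums termdiff_converges_all assms)
  then have "(\<lambda>n. of_nat (Suc n) * c (Suc n) * x ^ Suc n) sums (x * (\<Sum>n. diffs c n * x ^ n))"
    by (simp add: diffs_def mult_ac)
  then show ?thesis by (subst (asm) sums_Suc_iff) simp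
qed

text \<open>For positive \<open>k\<close> this is the defining recursion with denominators cleared.
  At \<open>k = 0\<close> it reads 5/2 - 5/2 = 0, which is where the initial values 5/2 and 1 fit
  together.\<close>

lemma X0_coeff_Suc:
  "2 * (real k + 1) * (4 * (real k)\<^sup>2 + 5 / 4) * X0_coeff (Suc k) + (2 * real k - 1) * X0_coeff k = 0"
proof (cases k)
  case (Suc j)
  define m where "m = real (Suc j)"
  have "4 * m\<^sup>2 + 5 / 4 > 0" "m + 1 > 0" by (auto simp: m_def intro: add_nonneg_pos)
  then have nz: "2 * (m + 1) * (4 * m\<^sup>2 + 5 / 4) \<noteq> 0" by simp
  have rec: "X0_coeff (Suc (Suc j)) =
      - ((2 * m - 1) * X0_coeff (Suc j)) / (2 * (m + 1) * (4 * m\<^sup>2 + 5 / 4))"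
    by (simp only: X0_coeff.simps Let_def m_def)
  show ?thesis
    unfolding Suc rec m_def[symmetric] using nz by simp
qed simp

text \<open>The recursion and \<open>\<bar>2 * m - 1\<bar> \<le> 2 * (4 * m\<^sup>2 + 5 / 4)\<close>
  give a ratio of at most 1/(k+1), as for the exponential series. Hence the series is entire, over
  the reals and over the complex numbers.\<close>

lemma abs_X0_coeff_le: "\<bar>X0_coeff k\<bar> \<le> 5 / 2 / fact k"
proof (induction k)
  case (Suc k)
  define m where "m = real k"
  have m: "m \<ge> 0" by (simp add: m_def)
  have pos: "2 * (4 * m\<^sup>2 + 5 / 4) > 0" by (intro mult_pos_pos add_nonneg_pos) auto
  have sq: "m * 4 \<le> 4 * m\<^sup>2 + 1" using zero_le_power2[of "2 * m - 1"] by (simp add: power2_eq_square algebra_simps)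
  have "(m + 1) * X0_coeff (Suc k) * (2 * (4 * m\<^sup>2 + 5 / 4)) = - ((2 * m - 1) * X0_coeff k)"
    using X0_coeff_Suc[of k] by (simp add: m_def algebra_simps)
  from arg_cong[OF this, of abs]
  have "(m + 1) * \<bar>X0_coeff (Suc k)\<bar> * (2 * (4 * m\<^sup>2 + 5 / 4)) = \<bar>2 * m - 1\<bar> * \<bar>X0_coeff k\<bar>"
    using pos by (simp only: abs_mult[of _ "2 * (4 * m\<^sup>2 + 5 / 4)"] abs_mult abs_minus_cancel abs_of_pos)
      (simp add: m_def)
  also have "\<dots> \<le> (2 * (4 * m\<^sup>2 + 5 / 4)) * \<bar>X0_coeff k\<bar>"
  proof (rule mult_right_mono)
    show "\<bar>2 * m - 1\<bar> \<le> 2 * (4 * m\<^sup>2 + 5 / 4)" 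
      using sq m zero_le_power2[of m] unfolding abs_le_iff by argo
  qed simp
  finally have "(m + 1) * \<bar>X0_coeff (Suc k)\<bar> \<le> \<bar>X0_coeff k\<bar>"
    using pos by (simp add: mult.commute)
  also have "\<dots> \<le> 5 / 2 / fact k" by (rule Suc)
  finally have "\<bar>X0_coeff (Suc k)\<bar> \<le> 5 / 2 / fact k / (m + 1)"
    using m by (subst pos_le_divide_eq) (simp_all add: mult.commute)
  also have "5 / 2 / fact k / (m + 1) = 5 / 2 / fact (Suc k)" by (simp add: m_def mult_ac)
  finally show ?case .
qed simp

lemma summable_X0_coeff:
  fixes z :: "'a::{real_normed_field,banach}"
  shows "summable (\<lambda>n. of_real (X0_coeff n) * z ^ n)"
proof (rule summable_comparison_test')
  show "summable (\<lambda>n. 5 / 2 * (inverse (fact n) * norm z ^ n))"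
    by (intro summable_mult summable_exp)
  show "norm (of_real (X0_coeff n) * z ^ n) \<le> 5 / 2 * (inverse (fact n) * norm z ^ n)" for n
    using mult_right_mono[OF abs_X0_coeff_le, of "norm z ^ n" n]
    by (simp add: norm_mult norm_power field_simps)
qed

text \<open>The j-th derivative of the entire function g with X_0(x) = g(x^2). Leaving the field
  open lets one definition serve both the real line and the complex extension.\<close>

definition X0_series :: "nat \<Rightarrow> 'a::{real_normed_field,banach} \<Rightarrow> 'a"
  where "X0_series j z = (\<Sum>n. (diffs ^^ j) (\<lambda>n. of_real (X0_coeff n)) n * z ^ n)"

lemma X0_series_sums:
  "(\<lambda>n. (diffs ^^ j) (\<lambda>n. of_real (X0_coeff n)) n * z ^ n) sums X0_series j z"
  unfolding X0_series_def by (intro summable_sums summable_diffs_funpow summable_X0_coeff)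

lemma DERIV_X0_series [derivative_intros]:
  assumes "(g has_field_derivative g') (at x within S)"
  shows "((\<lambda>x. X0_series j (g x)) has_field_derivative X0_series (Suc j) (g x) * g') (at x within S)"
proof (rule DERIV_chain2[OF _ assms])
  show "(X0_series j has_field_derivative X0_series (Suc j) (g x)) (at (g x))"
    unfolding X0_series_def[abs_def] funpow.simps comp_def
    by (intro termdiffs_strong_converges_everywhere summable_diffs_funpow summable_X0_coeff)
qed

lemma X0_series_of_real: "X0_series j (of_real t :: complex) = of_real (X0_series j t)"
proof -
  have "(diffs ^^ j) (\<lambda>n. of_real (X0_coeff n)) n = (of_real ((diffs ^^ j) X0_coeff n) :: complex)" for n
    by (induction j arbitrary: n) (simp_all add: diffs_def)
  then have "(\<lambda>n. of_real ((diffs ^^ j) X0_coeff n * t ^ n)) sums X0_series j (of_real t :: complex)"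
    using X0_series_sums[of j "of_real t :: complex"] by simp
  moreover have "(\<lambda>n. of_real ((diffs ^^ j) X0_coeff n * t ^ n)) sums (of_real (X0_series j t) :: complex)"
    using X0_series_sums[of j t] by (simp only: sums_of_real_iff) simp
  ultimately show ?thesis by (rule sums_unique2)
qed

lemma X0_eq: "X0 x = X0_series 0 (x\<^sup>2)"
  by (simp add: X0_def X0_series_def power_mult)

lemma dX0_eq: "dX0 x = 2 * x * X0_series 1 (x\<^sup>2)"
  unfolding dX0_def X0_eq[abs_def]
  by (rule DERIV_imp_deriv) (auto intro!: derivative_eq_intros)

text \<open>This removes the case distinction at 0: the prescribed value 2 is 2 g'(0), because g'(0)
  is the coefficient a_1 = 1.\<close>

lemma X0q_eq: "X0q x = 2 * X0_series 1 (x\<^sup>2)"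
  using powser_sums_zero[of "diffs X0_coeff"]
  by (auto simp: X0q_def dX0_eq X0_series_def diffs_def)

lemma ddX0_eq: "ddX0 x = 2 * X0_series 1 (x\<^sup>2) + 4 * x\<^sup>2 * X0_series 2 (x\<^sup>2)"
  unfolding ddX0_def dX0_eq[abs_def]
  by (rule DERIV_imp_deriv) (auto intro!: derivative_eq_intros simp: power2_eq_square numeral_2_eq_2)

lemma C2_eq: "C\<^sub>2 x = 4 * x\<^sup>2 * X0_series 2 (x\<^sup>2)"
  by (simp add: C\<^sub>2_def ddX0_eq X0q_eq)

text \<open>Put P(t) = t g''(t). The recursion says 16 t P' + 5 g' - 2 g + 4 t g' = 0, and
  multiplying by 2 g'' turns the left side into the derivative of \<open>E\<close>. So
  \<open>E\<close> is constant, and at t = 0 it equals 5 + 5 - 4 (5/2) = 0.\<close>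

lemma X0_first_integral:
  fixes t :: real
  shows "16 * (t * X0_series 2 t)\<^sup>2 + 5 * (X0_series 1 t)\<^sup>2 + 5
    + 4 * t * (X0_series 1 t)\<^sup>2 = 4 * X0_series 0 t * X0_series 1 t"
proof -
  let ?b = "diffs X0_coeff"
  \<comment> \<open>\<open>P\<close> is introduced through its coefficients, so that
    \<open>P'\<close> comes from differentiating its own series and the Euler operator can be
    applied a second time.\<close>
  define P where "P t = (\<Sum>n. (real n * ?b n) * t ^ n)" for t
  define P' where "P' t = (\<Sum>n. diffs (\<lambda>n. real n * ?b n) n * t ^ n)" for t
  have sb: "summable (\<lambda>n. ?b n * t ^ n)" for t
    using X0_series_sums[of 1 t] by (simp add: sums_iff)
  have P_sums: "(\<lambda>n. (real n * ?b n) * t ^ n) sums (t * X0_series 2 t)" for t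
    using powser_of_nat_mult_sums[OF sb] by (simp add: X0_series_def numeral_2_eq_2)
  have sP: "summable (\<lambda>n. (real n * ?b n) * t ^ n)" for t
    using P_sums sums_summable by blast
  have P: "P t = t * X0_series 2 t" for t
    using P_sums by (simp add: P_def sums_iff)
  have dP: "(P has_real_derivative P' t) (at t)" for t
    unfolding P_def[abs_def] P'_def
    by (intro termdiffs_strong_converges_everywhere sP)
  have ode: "16 * (t * P' t) + 5 * X0_series 1 t - 2 * X0_series 0 t + 4 * (t * X0_series 1 t) = 0" for t
  proof -
    have "(\<lambda>n. real n * (real n * ?b n) * t ^ n) sums (t * P' t)"
      unfolding P'_def using powser_of_nat_mult_sums[OF sP] by simp
    moreover have "(\<lambda>n. real n * X0_coeff n * t ^ n) sums (t * X0_series 1 t)"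
      using powser_of_nat_mult_sums[of X0_coeff t] summable_X0_coeff[where ?'a = real]
      by (simp add: X0_series_def)
    moreover have "(\<lambda>n. ?b n * t ^ n) sums X0_series 1 t" "(\<lambda>n. X0_coeff n * t ^ n) sums X0_series 0 t"
      using X0_series_sums[of 1 t] X0_series_sums[of 0 t] by simp_all
    ultimately have "(\<lambda>n. 16 * (real n * (real n * ?b n) * t ^ n) + 5 * (?b n * t ^ n)
        - 2 * (X0_coeff n * t ^ n) + 4 * (real n * X0_coeff n * t ^ n)) sums
        (16 * (t * P' t) + 5 * X0_series 1 t - 2 * X0_series 0 t + 4 * (t * X0_series 1 t))"
      by (intro sums_add sums_diff sums_mult)
    moreover have "16 * (real n * (real n * ?b n) * t ^ n) + 5 * (?b n * t ^ n)
        - 2 * (X0_coeff n * t ^ n) + 4 * (real n * X0_coeff n * t ^ n) = 0" for n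
    proof -
      \<comment> \<open>As \<open>?b n\<close> is (n+1) a_(n+1), the n-th term of the equation is
        the recursion at index n, scaled by 2 t^n.\<close>
      have "16 * (real n * (real n * ?b n) * t ^ n) + 5 * (?b n * t ^ n)
        - 2 * (X0_coeff n * t ^ n) + 4 * (real n * X0_coeff n * t ^ n) =
        2 * t ^ n * (2 * (real n + 1) * (4 * (real n)\<^sup>2 + 5 / 4) * X0_coeff (Suc n)
          + (2 * real n - 1) * X0_coeff n)"
        by (simp add: diffs_def algebra_simps power2_eq_square)
      then show ?thesis by (simp only: X0_coeff_Suc mult_zero_right)
    qed
    ultimately have "(\<lambda>n. 0) sums (16 * (t * P' t) + 5 * X0_series 1 t - 2 * X0_series 0 t + 4 * (t * X0_series 1 t))"
      by (simp only:)
    then show ?thesis using sums_zero by (rule sums_unique2)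
  qed
  define p :: "nat \<Rightarrow> real \<Rightarrow> real" where "p = X0_series"
  have dp: "(p j has_real_derivative p (Suc j) t) (at t)" for j t
    using DERIV_X0_series[OF DERIV_ident, of j t] by (simp add: p_def)
  have dp0: "(p 0 has_real_derivative p 1 t) (at t)" and dp1: "(p 1 has_real_derivative p 2 t) (at t)" for t
    using dp[of 0 t] dp[of 1 t] by (simp_all add: numeral_2_eq_2)
  define E where "E t = 16 * (P t)\<^sup>2 + 5 * (p 1 t)\<^sup>2 + 5 + 4 * t * (p 1 t)\<^sup>2 - 4 * p 0 t * p 1 t" for t
  have "(E has_real_derivative 0) (at t)" for t
  proof -
    have "(E has_real_derivative 32 * P t * P' t + 10 * p 1 t * p 2 t + (4 * (p 1 t)\<^sup>2 + 8 * t * p 1 t * p 2 t)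
        - (4 * p 1 t * p 1 t + 4 * p 0 t * p 2 t)) (at t)"
      unfolding E_def[abs_def]
      by (rule derivative_eq_intros dP dp0 dp1 refl | simp)+
    also have "32 * P t * P' t + 10 * p 1 t * p 2 t + (4 * (p 1 t)\<^sup>2 + 8 * t * p 1 t * p 2 t)
        - (4 * p 1 t * p 1 t + 4 * p 0 t * p 2 t) =
        2 * p 2 t * (16 * (t * P' t) + 5 * p 1 t - 2 * p 0 t + 4 * (t * p 1 t))"
      unfolding P p_def by (simp add: algebra_simps power2_eq_square del: One_nat_def)
    finally show ?thesis by (simp only: ode p_def mult_zero_right)
  qed
  then have "E t = E 0" using DERIV_isconst_all by blast
  moreover have "X0_series 0 0 = (5 / 2 :: real)" "X0_series 1 0 = (1 :: real)"
    using powser_sums_zero[of X0_coeff] powser_sums_zero[of ?b]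
    by (auto simp: X0_series_def diffs_def)
  ultimately show ?thesis by (simp add: E_def P p_def)
qed

section \<open>Positivity of \<open>X0q\<close> and the sum of squares of \<open>B\<^sub>2\<close>
  and \<open>C\<^sub>2\<close>\<close>

text \<open>Since g'(0) = 1, a nonpositive value of g' would force a zero by the intermediate value
  theorem. At a zero of g' the first integral becomes 16 (t g'')^2 + 5 = 0, which is
  impossible.\<close>

lemma X0q_pos: "X0q x > 0"
proof (rule ccontr)
  assume "\<not> X0q x > 0"
  then have "X0_series 1 (x\<^sup>2) \<le> 0" by (simp add: X0q_eq)
  moreover have "X0_series 1 0 = (1::real)"
    using X0q_eq[of 0] by (simp add: X0q_def)
  moreover have "continuous_on {0..x\<^sup>2} (X0_series 1 :: real \<Rightarrow> real)"
    by (intro DERIV_continuous_on) (auto intro!: derivative_eq_intros)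
  ultimately obtain t :: real where "X0_series 1 t = 0"
    using IVT2'[of "X0_series 1" "x\<^sup>2" 0 0] by auto
  moreover have "16 * (t * X0_series 2 t)\<^sup>2 + 5 > 0" by (intro add_nonneg_pos) auto
  ultimately show False using X0_first_integral[of t] by simp
qed

text \<open>With t = x^2 one has \<open>B\<^sub>2\<close> = -(g' + sqrt 5) and
  \<open>C\<^sub>2\<close> = 4 t g''. The first integral replaces the terms 16 (t g'')^2 + 5 in the
  expanded sum of squares, after which g' factors out.\<close>

lemma B2_C2_squares:
  "(B\<^sub>2 x)\<^sup>2 + (C\<^sub>2 x)\<^sup>2 = X0q x * (2 * X0 x - x * dX0 x - X0q x + sqrt 5)"
  using X0_first_integral[of "x\<^sup>2"]
  by (simp add: B\<^sub>2_def C2_eq X0q_eq X0_eq dX0_eq power2_eq_square algebra_simps)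

lemma B2_C2_squares_pos: "(B\<^sub>2 x)\<^sup>2 + (C\<^sub>2 x)\<^sup>2 > 0"
proof -
  have "0 < X0q x / 2 + sqrt 5" using X0q_pos[of x] by (intro add_pos_pos) auto
  then have "B\<^sub>2 x < 0" by (simp add: B\<^sub>2_def)
  then show ?thesis by (simp add: add_pos_nonneg)
qed

lemma rad_pos: "rad x > 0"
  unfolding rad_def powr_gt_zero using B2_C2_squares_pos[of x] by (rule less_imp_neq[symmetric])

lemma rad_squared: "(rad x)\<^sup>2 * ((B\<^sub>2 x)\<^sup>2 + (C\<^sub>2 x)\<^sup>2) = 1"
proof -
  have "(rad x)\<^sup>2 = ((B\<^sub>2 x)\<^sup>2 + (C\<^sub>2 x)\<^sup>2) powr (- 1)"
    by (simp add: rad_def power2_eq_square flip: powr_add)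
  then show ?thesis using B2_C2_squares_pos[of x]
    by (simp only: powr_minus powr_one less_imp_le left_inverse[OF less_imp_neq[OF B2_C2_squares_pos, symmetric]])
qed

section \<open>Analyticity of \<open>B\<^sub>2\<close>, \<open>C\<^sub>2\<close> and
  \<open>rad\<close> by holomorphic extension\<close>

lemma X0_series_holomorphic:
  assumes "g holomorphic_on S"
  shows "(\<lambda>z. X0_series j (g z)) holomorphic_on S"
proof -
  have "X0_series j holomorphic_on UNIV"
    using DERIV_X0_series[OF DERIV_ident]
    by (auto simp: holomorphic_on_def field_differentiable_def)
  then show ?thesis
    using holomorphic_on_compose_gen[OF assms] by (auto simp: comp_def)
qed

definition B2_ext :: "complex \<Rightarrow> complex"
  where "B2_ext z = - X0_series 1 (z\<^sup>2) - of_real (sqrt 5)"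

definition C2_ext :: "complex \<Rightarrow> complex"
  where "C2_ext z = 4 * z\<^sup>2 * X0_series 2 (z\<^sup>2)"

lemma B2_ext_holomorphic: "B2_ext holomorphic_on S"
  unfolding B2_ext_def[abs_def] by (intro holomorphic_intros X0_series_holomorphic)

lemma C2_ext_holomorphic: "C2_ext holomorphic_on S"
  unfolding C2_ext_def[abs_def] by (intro holomorphic_intros X0_series_holomorphic)

lemma B2_ext_of_real: "B2_ext (of_real x) = of_real (B\<^sub>2 x)"
  using X0_series_of_real[of 1 "x\<^sup>2"] by (simp add: B2_ext_def B\<^sub>2_def X0q_eq)

lemma C2_ext_of_real: "C2_ext (of_real x) = of_real (C\<^sub>2 x)"
  using X0_series_of_real[of 2 "x\<^sup>2"] by (simp add: C2_ext_def C2_eq)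

lemma real_analytic_on_B2: "real_analytic_on B\<^sub>2 S"
  by (rule real_analytic_on_holomorphic_extension[OF B2_ext_holomorphic[of UNIV]])
    (simp_all add: B2_ext_of_real)

lemma real_analytic_on_C2: "real_analytic_on C\<^sub>2 S"
  by (rule real_analytic_on_holomorphic_extension[OF C2_ext_holomorphic[of UNIV]])
    (simp_all add: C2_ext_of_real)

lemma real_analytic_on_rad: "real_analytic_on rad S"
proof -
  define H where "H z = (B2_ext z)\<^sup>2 + (C2_ext z)\<^sup>2" for z
  \<comment> \<open>The principal power is holomorphic off the nonpositive real axis.
    \<open>U\<close> is the preimage of that slit plane under \<open>H\<close>, and it contains the
    real line because \<open>H\<close> is positive there.\<close>
  define U where "U = H -` (- \<real>\<^sub>\<le>\<^sub>0)"
  have H: "H holomorphic_on T" for T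
    unfolding H_def by (intro holomorphic_intros B2_ext_holomorphic C2_ext_holomorphic)
  have H_real: "H (of_real x) = of_real ((B\<^sub>2 x)\<^sup>2 + (C\<^sub>2 x)\<^sup>2)" for x
    by (simp add: H_def B2_ext_of_real C2_ext_of_real)
  have "open U"
    unfolding U_def by (intro open_vimage holomorphic_on_imp_continuous_on H) auto
  moreover have "(\<lambda>z. H z powr of_real (- 1 / 2)) holomorphic_on U"
    by (intro holomorphic_intros H) (auto simp: U_def)
  moreover have "of_real x \<in> U" for x
    using B2_C2_squares_pos[of x] by (simp add: U_def H_real complex_nonpos_Reals_iff
        flip: of_real_power of_real_add)
  moreover have "Re (H (of_real x) powr of_real (- 1 / 2)) = rad x" for x
    unfolding H_real rad_def
    using B2_C2_squares_pos[of x] by (subst powr_of_real) auto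
  ultimately show ?thesis
    by (intro real_analytic_on_holomorphic_extension[where U = U]) auto
qed

section \<open>Derivatives along y-curves, and surfaces sharing one frame\<close>

lemma b2_eq: "b\<^sub>2 x y = 2 * y / h x y * B\<^sub>2 x"
proof -
  have "B\<^sub>2 x = - (X0q x / 2 + sqrt 5)" by (simp add: B\<^sub>2_def)
  then show ?thesis by (simp only: b\<^sub>2_def mult_minus_left mult_minus_right)
qed

lemma c2_eq: "c\<^sub>2 x y = 2 * y / h x y * C\<^sub>2 x"
  by (simp add: c\<^sub>2_def C\<^sub>2_def)

lemma convex_D: "convex D"
proof -
  have "D = {0<..} \<times> UNIV" by (auto simp: D_def)
  then show ?thesis using convex_Times[of "{0::real<..}" "UNIV :: real set"] by simp
qed

lemma has_vector_derivative_zero_eq: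
  fixes g :: "real \<Rightarrow> 'a::real_normed_vector"
  assumes "\<And>y. (g has_vector_derivative 0) (at y)"
  shows "g y = g z"
proof -
  obtain c where "\<And>y. y \<in> UNIV \<Longrightarrow> g y = c"
    by (rule has_vector_derivative_zero_constant[OF convex_UNIV assms]) blast
  then show ?thesis by simp
qed

lemma curvature_surface_partial_y:
  assumes "curvature_surface X\<^sub>\<alpha> X\<^sub>\<beta> f" "x > 0"
  shows "((\<lambda>t. f (x, t)) has_vector_derivative (2 * y / h x y) *\<^sub>R X\<^sub>\<beta> (x, y)) (at y)"
proof -
  have f: "(f has_derivative (\<lambda>(dx, dy). ((x\<^sup>2 - y\<^sup>2) / (x * h x y) * dx) *\<^sub>R X\<^sub>\<alpha> (x, y)
                  + (2 * y / h x y * dy) *\<^sub>R X\<^sub>\<beta> (x, y))) (at (x, y))"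
    using assms by (auto simp: curvature_surface_def D_def)
  have "((\<lambda>t. (x, t)) has_derivative (\<lambda>t. (0, t))) (at y)"
    by (auto intro!: derivative_eq_intros)
  from has_derivative_compose[OF this f]
  have "((\<lambda>t. f (x, t)) has_derivative (\<lambda>t. (2 * y / h x y * t) *\<^sub>R X\<^sub>\<beta> (x, y))) (at y)"
    by simp
  then show ?thesis by (simp add: has_vector_derivative_def mult.commute)
qed

text \<open>The frame prescribes the whole differential, so the difference of two surfaces has
  derivative zero on the convex set \<open>D\<close>.\<close>

lemma curvature_surface_diff_const:
  assumes "curvature_surface X\<^sub>\<alpha> X\<^sub>\<beta> f" "curvature_surface X\<^sub>\<alpha> X\<^sub>\<beta> g"
  obtains v where "\<And>p. p \<in> D \<Longrightarrow> g p = f p + v"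
proof -
  have D0: "((\<lambda>p. g p - f p) has_derivative (\<lambda>_. 0)) (at p within D)" if "p \<in> D" for p
  proof -
    obtain L where "(f has_derivative L) (at p)" "(g has_derivative L) (at p)"
      using assms \<open>p \<in> D\<close> unfolding curvature_surface_def by (cases p) blast
    then show ?thesis
      using has_derivative_diff[of g L "at p" f L] has_derivative_at_withinI by fastforce
  qed
  obtain v where "\<And>p. p \<in> D \<Longrightarrow> g p - f p = v"
    using has_derivative_zero_constant[OF convex_D D0] by blast
  then have "g p = f p + v" if "p \<in> D" for p
    using that by (simp add: diff_eq_eq add.commute)
  then show thesis by (rule that)
qed

lemma curvature_surface_translate:
  assumes "curvature_surface X\<^sub>\<alpha> X\<^sub>\<beta> f"
  shows "curvature_surface X\<^sub>\<alpha> X\<^sub>\<beta> (\<lambda>p. f p + v)"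
  using assms unfolding curvature_surface_def
  by (auto intro!: real_analytic2_on_add real_analytic2_on_const has_derivative_add_const)

theorem theorem3p6:
  fixes \<phi> X\<^sub>\<alpha> X\<^sub>\<beta> \<xi> f :: "real \<times> real \<Rightarrow> real^4"
  assumes frame: "frame_field \<phi> X\<^sub>\<alpha> X\<^sub>\<beta> \<xi>"
    and surface: "curvature_surface X\<^sub>\<alpha> X\<^sub>\<beta> f"
  shows
    "(\<forall>x>0. \<exists>v. \<forall>y. - B\<^sub>2 x *\<^sub>R X\<^sub>\<alpha> (x, y) + C\<^sub>2 x *\<^sub>R \<xi> (x, y) = v) \<and>
     (\<forall>x. (B\<^sub>2 x)\<^sup>2 + (C\<^sub>2 x)\<^sup>2 = X0q x * (2 * X0 x - x * dX0 x - X0q x + sqrt 5) \<and>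
          (B\<^sub>2 x)\<^sup>2 + (C\<^sub>2 x)\<^sup>2 > 0) \<and>
     real_analytic2_on (f_tilde X\<^sub>\<alpha> \<xi>) D \<and>
     (\<forall>p\<in>D. norm (f_tilde X\<^sub>\<alpha> \<xi> p) = 1) \<and>
     (\<exists>u A :: real \<Rightarrow> real^4.
        \<comment> \<open>(1)\<close>
        real_analytic_on u {0<..} \<and>
        (\<forall>x>0. norm (u x) = 1) \<and>
        (\<forall>x>0. \<forall>y. u x = rad x *\<^sub>R (- B\<^sub>2 x *\<^sub>R X\<^sub>\<alpha> (x, y) + C\<^sub>2 x *\<^sub>R \<xi> (x, y))) \<and>
        \<comment> \<open>(2)\<close>
        real_analytic_on A {0<..} \<and>
        (\<forall>x>0. \<forall>y. f (x, y) = rad x *\<^sub>R f_tilde X\<^sub>\<alpha> \<xi> (x, y) + A x) \<and>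
        (\<forall>A'. (\<exists>g. curvature_surface X\<^sub>\<alpha> X\<^sub>\<beta> g \<and>
                   (\<forall>x>0. \<forall>y. g (x, y) = rad x *\<^sub>R f_tilde X\<^sub>\<alpha> \<xi> (x, y) + A' x)) \<longleftrightarrow>
              (\<exists>v. \<forall>x>0. A' x = A x + v)) \<and>
        \<comment> \<open>(3)\<close>
        (\<forall>x>0. \<exists>d. A x \<in> {p. u x \<bullet> p = d} \<and>
               (\<forall>y. f (x, y) \<in> {p. u x \<bullet> p = d} \<inter> sphere (A x) (rad x))))"
proof -
  have D_iff: "(x, y) \<in> D \<longleftrightarrow> x > 0" for x y by (simp add: D_def)
  note frame' = frame[unfolded frame_field_def]
  have an: "real_analytic2_on X\<^sub>\<alpha> D" "real_analytic2_on \<xi> D" "real_analytic2_on f D"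
    using frame' surface by (auto simp: curvature_surface_def)
  have orth: "orthonormal_frame (\<phi> (x, y)) (X\<^sub>\<alpha> (x, y)) (X\<^sub>\<beta> (x, y)) (\<xi> (x, y))" if "x > 0" for x y
    using frame' that by (auto simp: D_iff)
  have inner: "X\<^sub>\<alpha> (x, y) \<bullet> X\<^sub>\<alpha> (x, y) = 1" "\<xi> (x, y) \<bullet> \<xi> (x, y) = 1"
      "X\<^sub>\<alpha> (x, y) \<bullet> \<xi> (x, y) = 0" "\<xi> (x, y) \<bullet> X\<^sub>\<alpha> (x, y) = 0" if "x > 0" for x y
    using orth[OF that, of y] by (auto simp: orthonormal_frame_def norm_eq_1 inner_commute)
  have dX: "((\<lambda>t. X\<^sub>\<alpha> (x, t)) has_vector_derivative (2 * y / h x y * C\<^sub>2 x) *\<^sub>R X\<^sub>\<beta> (x, y)) (at y)"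
    if "x > 0" for x y
    using frame' that by (auto simp: D_iff c2_eq)
  have d\<xi>: "((\<lambda>t. \<xi> (x, t)) has_vector_derivative (2 * y / h x y * B\<^sub>2 x) *\<^sub>R X\<^sub>\<beta> (x, y)) (at y)"
    if "x > 0" for x y
    using frame' that by (auto simp: D_iff b2_eq)

  \<comment> \<open>\<open>w\<close> is the unnormalised vector of (1). \<open>u\<close> and
    \<open>A\<close> are read off at y = 0: this makes them functions of x alone, analytic as
    slices, and \<open>w_const\<close> and \<open>A_const\<close> then show that any other y gives
    the same value.\<close>
  define w where "w x y = - B\<^sub>2 x *\<^sub>R X\<^sub>\<alpha> (x, y) + C\<^sub>2 x *\<^sub>R \<xi> (x, y)" for x y
  define F where "F = f_tilde X\<^sub>\<alpha> \<xi>"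
  define u where "u x = rad x *\<^sub>R w x 0" for x
  define A where "A x = f (x, 0) - rad x *\<^sub>R F (x, 0)" for x
  have F: "F (x, y) = rad x *\<^sub>R (B\<^sub>2 x *\<^sub>R \<xi> (x, y) + C\<^sub>2 x *\<^sub>R X\<^sub>\<alpha> (x, y))" for x y
    by (simp add: F_def f_tilde_def)

  have w_const: "w x y = w x 0" if "x > 0" for x y
  proof (rule has_vector_derivative_zero_eq)
    fix y
    show "(w x has_vector_derivative 0) (at y)"
      unfolding w_def[abs_def]
      \<comment> \<open>With k = 2y/h the derivative is (-B_2 k C_2 + C_2 k B_2) times the vector
        \<open>X\<^sub>\<beta>\<close>, and the two terms cancel.\<close>
      by (rule has_vector_derivative_eq_rhs,
          rule has_vector_derivative_add[OF
            bounded_linear.has_vector_derivative[OF bounded_linear_scaleR_right dX[OF that]]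
            bounded_linear.has_vector_derivative[OF bounded_linear_scaleR_right d\<xi>[OF that]]])
        (simp add: algebra_simps)
  qed
  have A_const: "f (x, y) - rad x *\<^sub>R F (x, y) = A x" if "x > 0" for x y
    unfolding A_def
  proof (rule has_vector_derivative_zero_eq)
    fix y
    \<comment> \<open>Pulling out the common factor 2y/h leaves \<open>rad\<close> squared times the
      sum of squares, which is 1. So \<open>rad x *\<^sub>R F (x, t)\<close> has the same derivative
      in \<open>t\<close> as the surface.\<close>
    have eq: "rad x * (rad x * (B\<^sub>2 x * (2 * y / h x y * B\<^sub>2 x) + C\<^sub>2 x * (2 * y / h x y * C\<^sub>2 x))) = 2 * y / h x y"
    proof -
      have "rad x * (rad x * (B\<^sub>2 x * (k * B\<^sub>2 x) + C\<^sub>2 x * (k * C\<^sub>2 x))) = k * ((rad x)\<^sup>2 * ((B\<^sub>2 x)\<^sup>2 + (C\<^sub>2 x)\<^sup>2))" for k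
        by (simp add: power2_eq_square algebra_simps)
      then show ?thesis by (simp only: rad_squared mult_1_right)
    qed
    have "((\<lambda>t. rad x *\<^sub>R F (x, t)) has_vector_derivative (2 * y / h x y) *\<^sub>R X\<^sub>\<beta> (x, y)) (at y)"
      unfolding F
      by (rule has_vector_derivative_eq_rhs,
          rule bounded_linear.has_vector_derivative[OF bounded_linear_scaleR_right
            bounded_linear.has_vector_derivative[OF bounded_linear_scaleR_right
             has_vector_derivative_add[OF
            bounded_linear.has_vector_derivative[OF bounded_linear_scaleR_right d\<xi>[OF that]]
            bounded_linear.has_vector_derivative[OF bounded_linear_scaleR_right dX[OF that]]]]])
        (simp only: scaleR_scaleR scaleR_add_left[symmetric] eq)
    from has_vector_derivative_diff[OF curvature_surface_partial_y[OF surface that] this]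
    show "((\<lambda>y. f (x, y) - rad x *\<^sub>R F (x, y)) has_vector_derivative 0) (at y)"
      by simp
  qed

  note an_scale = real_analytic2_on_scaleR_left[OF _ _ subset_UNIV]
  have an_F: "real_analytic2_on F D"
    using an_scale[OF real_analytic_on_rad real_analytic2_on_add[OF
        an_scale[OF real_analytic_on_B2 an(2)] an_scale[OF real_analytic_on_C2 an(1)]]]
    by (rule back_subst[where P = "\<lambda>F. real_analytic2_on F D"]) (auto simp: F)
  \<comment> \<open>The slice of this difference at y = 0 is \<open>A\<close>.\<close>
  have "real_analytic2_on (\<lambda>p. f p + - (case p of (x, y) \<Rightarrow> rad x *\<^sub>R F (x, y))) D"
    by (intro real_analytic2_on_add an real_analytic2_on_uminus an_scale real_analytic_on_rad an_F)
  from real_analytic_on_slice[OF this, of "{0<..}" 0]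
  have an_A: "real_analytic_on A {0<..}" by (simp add: A_def[abs_def] D_iff)
  have "real_analytic2_on (\<lambda>(x, y). rad x *\<^sub>R w x y) D"
    using an_scale[OF real_analytic_on_rad real_analytic2_on_add[OF
        real_analytic2_on_uminus[OF an_scale[OF real_analytic_on_B2 an(1)]]
        an_scale[OF real_analytic_on_C2 an(2)]]]
    by (rule back_subst[where P = "\<lambda>F. real_analytic2_on F D"]) (auto simp: w_def)
  from real_analytic_on_slice[OF this, of "{0<..}" 0]
  have an_u: "real_analytic_on u {0<..}" by (simp add: u_def[abs_def] D_iff)
  have norm_F: "norm (F (x, y)) = 1" if "x > 0" for x y
  proof -
    have "F (x, y) \<bullet> F (x, y) = (rad x)\<^sup>2 * ((B\<^sub>2 x)\<^sup>2 + (C\<^sub>2 x)\<^sup>2)"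
      by (simp add: F inner[OF that] power2_eq_square algebra_simps)
    then show ?thesis by (simp add: norm_eq_1 rad_squared)
  qed
  have norm_u: "norm (u x) = 1" if "x > 0" for x
  proof -
    have "u x \<bullet> u x = (rad x)\<^sup>2 * ((B\<^sub>2 x)\<^sup>2 + (C\<^sub>2 x)\<^sup>2)"
      by (simp add: u_def w_def inner[OF that]
          power2_eq_square algebra_simps)
    then show ?thesis by (simp add: norm_eq_1 rad_squared)
  qed
  have u_eq: "u x = rad x *\<^sub>R w x y" if "x > 0" for x y
    using w_const[OF that, of y] by (simp add: u_def)
  \<comment> \<open>In the orthonormal pair \<open>X\<^sub>\<alpha>\<close>, \<open>\<xi>\<close>
    the two vectors are multiples of (-B_2, C_2) and (C_2, B_2), whose inner product
    vanishes.\<close>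
  have u_F: "u x \<bullet> F (x, y) = 0" if "x > 0" for x y
    unfolding u_eq[OF that, of y] F w_def
    by (simp add: inner[OF that] algebra_simps)
  have f_eq: "f (x, y) = rad x *\<^sub>R F (x, y) + A x" if "x > 0" for x y
    using A_const[OF that, of y] by (simp add: algebra_simps)
  \<comment> \<open>Uniqueness of the centre curve ranges over all surfaces with this frame. A
    competing surface differs from \<open>f\<close> by a constant, and comparing at y = 0 passes
    that constant to the centre; conversely, translating \<open>f\<close> by \<open>v\<close>
    realises the shift.\<close>
  have shift: "(\<exists>g. curvature_surface X\<^sub>\<alpha> X\<^sub>\<beta> g \<and> (\<forall>x>0. \<forall>y. g (x, y) = rad x *\<^sub>R F (x, y) + A' x))
      \<longleftrightarrow> (\<exists>v. \<forall>x>0. A' x = A x + v)" for A'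
  proof safe
    fix g assume g: "curvature_surface X\<^sub>\<alpha> X\<^sub>\<beta> g" "\<forall>x>0. \<forall>y. g (x, y) = rad x *\<^sub>R F (x, y) + A' x"
    obtain v where v: "\<And>p. p \<in> D \<Longrightarrow> g p = f p + v"
      using curvature_surface_diff_const[OF surface g(1)] by blast
    have "A' x = A x + v" if "x > 0" for x
      using v[of "(x, 0)"] g(2)[rule_format, OF that, of 0] f_eq[OF that, of 0] that
      by (simp add: D_iff add.assoc)
    then show "\<exists>v. \<forall>x>0. A' x = A x + v" by blast
  next
    fix v assume "\<forall>x>0. A' x = A x + v"
    then show "\<exists>g. curvature_surface X\<^sub>\<alpha> X\<^sub>\<beta> g \<and> (\<forall>x>0. \<forall>y. g (x, y) = rad x *\<^sub>R F (x, y) + A' x)"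
      using curvature_surface_translate[OF surface, of v] f_eq
      by (intro exI[of _ "\<lambda>p. f p + v"]) (simp add: add.assoc)
  qed
  \<comment> \<open>The level of the hyperplane is the one through the centre \<open>A x\<close>.
    The surface differs from it by \<open>rad x\<close> times the unit vector
    \<open>F (x, y)\<close>, which is orthogonal to \<open>u x\<close>.\<close>
  have sphere: "f (x, y) \<in> {p. u x \<bullet> p = u x \<bullet> A x} \<inter> sphere (A x) (rad x)" if "x > 0" for x y
    using rad_pos[of x] u_F[OF that, of y] norm_F[OF that, of y]
    by (simp add: f_eq[OF that] inner_add_right dist_norm norm_minus_commute)
  show ?thesis
    unfolding F_def[symmetric] w_def[symmetric]
  proof (intro conjI, goal_cases)
    case 1
    show ?case using w_const by blast
  next
    case 2
    show ?case using B2_C2_squares B2_C2_squares_pos by blast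
  next
    case 3
    show ?case by (rule an_F)
  next
    case 4
    show ?case using norm_F by (auto simp: D_iff)
  next
    case 5
    show ?case
    proof (rule exI[of _ u], rule exI[of _ A], intro conjI)
      show "real_analytic_on u {0<..}" "real_analytic_on A {0<..}" by (fact an_u an_A)+
      show "\<forall>x>0. norm (u x) = 1" using norm_u by blast
      show "\<forall>x>0. \<forall>y. u x = rad x *\<^sub>R w x y" using u_eq by blast
      show "\<forall>x>0. \<forall>y. f (x, y) = rad x *\<^sub>R F (x, y) + A x" using f_eq by blast
      show "\<forall>A'. (\<exists>g. curvature_surface X\<^sub>\<alpha> X\<^sub>\<beta> g \<and> (\<forall>x>0. \<forall>y. g (x, y) = rad x *\<^sub>R F (x, y) + A' x))
          \<longleftrightarrow> (\<exists>v. \<forall>x>0. A' x = A x + v)"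
        by (intro allI shift)
      show "\<forall>x>0. \<exists>d. A x \<in> {p. u x \<bullet> p = d} \<and>
          (\<forall>y. f (x, y) \<in> {p. u x \<bullet> p = d} \<inter> sphere (A x) (rad x))"
      proof (intro allI impI)
        fix x :: real assume "x > 0"
        then show "\<exists>d. A x \<in> {p. u x \<bullet> p = d} \<and>
            (\<forall>y. f (x, y) \<in> {p. u x \<bullet> p = d} \<inter> sphere (A x) (rad x))"
          using sphere by (intro exI[of _ "u x \<bullet> A x"]) blast
      qed
    qed
  qed
qed

end
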